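(* Let $G$ be a finitely generated group with property $\mathrm{RD}$, and let $A\subseteq G$ be a non-empty approximate semigroup. Then the limit $$\lim_{n\to\infty}\frac1n\log|A\cap B_n|$$ exists.
   Context: $G$ is equipped with the word length $|\cdot|$ of a fixed finite generating set, and $B_n=\{g\in G:|g|\le n\}$. For $t\in G$ let $\lambda(t)$ be the left regular representation on $\ell^2(G)$, $(\lambda(t)\xi)(h)=\xi(t^{-1}h)$, and for finitely supported $f:G\to\mathbb C$ put $\lambda(f)=\sum_{t\in G}f(t)\lambda(t)$, with operator norm $\|\lambda(f)\|$ on $\ell^2(G)$. For $s\ge0$ set $\|f\|_{\ell^2_s}^2=\sum_{g\in G}|f(g)|^2(1+|g|)^{2s}$. The group $G$ has property $\mathrm{RD}$ (Rapid Decay) if there exist $s\ge0$ and $C>0$ such that $\|\lambda(f)\|\le C\|f\|_{\ell^2_s}$ for every finitely supported $f:G\to\mathbb C$. A subset $A\subseteq G$ is an approximate semigroup if there is a finite subset $X\subseteq G$ such that $A^2\subseteq AX$, where $A^2=AA$. *)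

theory Defs
  imports Complex_Main "HOL-Algebra.Generated_Groups" "HOL-Analysis.Infinite_Sum"
begin

(* Letters of S and their inverses are allowed in words, so S need not be symmetric.
   The length is meaningful only for elements of the subgroup generated by S. *)
definition word_length :: "('a, 'b) monoid_scheme \<Rightarrow> 'a set \<Rightarrow> 'a \<Rightarrow> nat" where
  "word_length G S g =
     (LEAST n. \<exists>w. length w = n \<and> set w \<subseteq> S \<union> m_inv G ` S
        \<and> foldr (\<lambda>x y. x \<otimes>\<^bsub>G\<^esub> y) w \<one>\<^bsub>G\<^esub> = g)"

definition word_ball :: "('a, 'b) monoid_scheme \<Rightarrow> 'a set \<Rightarrow> nat \<Rightarrow> 'a set" where
  "word_ball G S n = {g \<in> carrier G. word_length G S g \<le> n}"

(* Functions G -> C are represented by functions on the whole type 'a; all notions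
   below depend only on the values on the carrier. *)

definition finitely_supported :: "('a, 'b) monoid_scheme \<Rightarrow> ('a \<Rightarrow> complex) \<Rightarrow> bool" where
  "finitely_supported G f \<longleftrightarrow> finite {g \<in> carrier G. f g \<noteq> 0}"

definition ell2 :: "('a, 'b) monoid_scheme \<Rightarrow> ('a \<Rightarrow> complex) set" where
  "ell2 G = {\<xi>. (\<lambda>g. (cmod (\<xi> g))\<^sup>2) summable_on carrier G}"

definition ell2_norm :: "('a, 'b) monoid_scheme \<Rightarrow> ('a \<Rightarrow> complex) \<Rightarrow> real" where
  "ell2_norm G \<xi> = sqrt (\<Sum>\<^sub>\<infinity>g\<in>carrier G. (cmod (\<xi> g))\<^sup>2)"

definition ell2_weighted_norm ::
    "('a, 'b) monoid_scheme \<Rightarrow> 'a set \<Rightarrow> real \<Rightarrow> ('a \<Rightarrow> complex) \<Rightarrow> real" where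
  "ell2_weighted_norm G S s f =
     sqrt (\<Sum>\<^sub>\<infinity>g\<in>carrier G. (cmod (f g))\<^sup>2 * (1 + real (word_length G S g)) powr (2 * s))"

definition left_regular ::
    "('a, 'b) monoid_scheme \<Rightarrow> 'a \<Rightarrow> ('a \<Rightarrow> complex) \<Rightarrow> 'a \<Rightarrow> complex" where
  "left_regular G t \<xi> h = \<xi> (inv\<^bsub>G\<^esub> t \<otimes>\<^bsub>G\<^esub> h)"

(* Linear extension of the regular representation to finitely supported f;
   the sum ranges over the support because HOL sums over infinite sets are 0. *)
definition left_regular_fun ::
    "('a, 'b) monoid_scheme \<Rightarrow> ('a \<Rightarrow> complex) \<Rightarrow> ('a \<Rightarrow> complex) \<Rightarrow> 'a \<Rightarrow> complex" where
  "left_regular_fun G f \<xi> h =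
     (\<Sum>t\<in>{t \<in> carrier G. f t \<noteq> 0}. f t * left_regular G t \<xi> h)"

(* Only meaningful for bounded operators from ell2 to ell2, for which the set below is
   bounded above.  If G is a group and f is finitely supported, left_regular_fun G f is
   such an operator, with norm at most the sum of the values cmod (f t). *)
definition ell2_op_norm ::
    "('a, 'b) monoid_scheme \<Rightarrow> (('a \<Rightarrow> complex) \<Rightarrow> 'a \<Rightarrow> complex) \<Rightarrow> real" where
  "ell2_op_norm G T = Sup {ell2_norm G (T \<xi>) | \<xi>. \<xi> \<in> ell2 G \<and> ell2_norm G \<xi> \<le> 1}"

definition rapid_decay :: "('a, 'b) monoid_scheme \<Rightarrow> 'a set \<Rightarrow> bool" where
  "rapid_decay G S \<longleftrightarrow>
     (\<exists>s\<ge>0. \<exists>C>0. \<forall>f. finitely_supported G f \<longrightarrow>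
        ell2_op_norm G (left_regular_fun G f) \<le> C * ell2_weighted_norm G S s f)"

definition approximate_semigroup :: "('a, 'b) monoid_scheme \<Rightarrow> 'a set \<Rightarrow> bool" where
  "approximate_semigroup G A \<longleftrightarrow>
     A \<subseteq> carrier G \<and>
     (\<exists>X. finite X \<and> X \<subseteq> carrier G \<and> A <#>\<^bsub>G\<^esub> A \<subseteq> A <#>\<^bsub>G\<^esub> X)"

end

theory Submission
  imports Defs "HOL-Analysis.Convex" "HOL-Real_Asymp.Real_Asymp"
begin

text \<open>
  Put \<open>a n = |A \<inter> B\<^sub>n|\<close>.  Two opposite estimates of the size of a product set
  show that \<open>a\<close> is supermultiplicative up to a polynomial factor and a bounded shift.

  From below, rapid decay says that products of two finite sets are large.  If \<open>P\<close> lies in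
  the ball of radius \<open>n\<close>, then convolution by the indicator of \<open>P\<close> has norm at most
  \<open>C (1 + n)\<^sup>s \<surd>|P|\<close>.  Convolving the indicators of \<open>P\<close> and \<open>Q\<close> yields a
  function of total mass \<open>|P| |Q|\<close> that lives on \<open>PQ\<close>, so Cauchy--Schwarz gives
  \<open>|P| |Q| \<le> C\<^sup>2 (1 + n)\<^sup>2\<^sup>s |PQ|\<close>.  Only the length in \<open>P\<close> enters this bound.

  From above, \<open>A\<^sup>2 \<subseteq> AX\<close> puts \<open>(A \<inter> B\<^sub>n) (A \<inter> B\<^sub>m)\<close> inside
  \<open>(A \<inter> B\<^bsub>n+m+c\<^esub>) X\<close>, where \<open>c\<close> bounds the lengths of the inverses of the
  elements of \<open>X\<close>.  With \<open>P = A \<inter> B\<^sub>n\<close> and \<open>Q = A \<inter> B\<^sub>m\<close> this gives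
  \<open>a n * a m \<le> C\<^sup>2 |X| (1 + n)\<^sup>2\<^sup>s a (n + m + c)\<close>.

  Hence \<open>u = ln a\<close> satisfies \<open>u m + u n \<le> u (m + n + c) + \<delta> n\<close> with
  \<open>\<delta> n = O(log n)\<close>.  Moreover \<open>u\<close> is monotone, and grows at most linearly because
  balls grow at most exponentially.  A variant of Fekete's lemma then gives the convergence of
  \<open>u n / n\<close>; its proof exploits that the error depends on one of the two arguments only.
\<close>

section \<open>A variant of Fekete's lemma\<close>

text \<open>
  The limit is the supremum \<open>L\<close> of \<open>(u n - \<delta> n) / (n + c)\<close>.  Since the error does
  not involve \<open>m\<close>, a fixed \<open>n\<close> can be added again and again: each step of length
  \<open>n + c\<close> gains at least \<open>u n - \<delta> n\<close>, so the lower limit of \<open>u m / m\<close> is at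
  least each of these quotients.  Conversely \<open>u n \<le> L (n + c) + \<delta> n\<close>.
\<close>

lemma almost_superadditive_convergent:
  fixes u \<delta> :: "nat \<Rightarrow> real" and c :: nat and D :: real
  assumes "mono u" and "u 0 \<ge> 0"
    and linear: "\<And>n. u n \<le> D * real n"
    and superadd: "\<And>m n. u m + u n \<le> u (m + n + c) + \<delta> n"
    and sublinear: "(\<lambda>n. \<delta> n / real n) \<longlonglongrightarrow> 0"
  shows "convergent (\<lambda>n. u n / real n)"
proof -
  define v where "v n = (u n - \<delta> n) / (real n + real c)" for n
  define L where "L = (SUP n\<in>{1..}. v n)"
  have bdd: "bdd_above (v ` {1..})"
  proof (rule bdd_aboveI2)
    fix n :: nat assume "n \<in> {1..}"
    moreover have "u n - \<delta> n \<le> D * (real n + real c)"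
      using superadd[of 0 n] linear[of "n + c"] \<open>u 0 \<ge> 0\<close> by simp
    ultimately show "v n \<le> D" by (simp add: v_def divide_le_eq)
  qed
  have multiples: "real k * (u n - \<delta> n) \<le> u (k * (n + c))" for k n
  proof (induction k)
    case 0
    then show ?case using \<open>u 0 \<ge> 0\<close> by simp
  next
    case (Suc k)
    have "k * (n + c) + n + c = Suc k * (n + c)" by simp
    with superadd[of "k * (n + c)" n] Suc show ?case by (simp add: algebra_simps)
  qed
  \<comment> \<open>Fit \<open>k = m div (n + c)\<close> whole steps below \<open>m\<close>; rounding costs at most one step's gain.\<close>
  have lower: "v n - \<bar>u n - \<delta> n\<bar> / real m \<le> u m / real m" if "n \<ge> 1" "m \<ge> 1" for n m
  proof -
    define p where "p = n + c"
    define w where "w = u n - \<delta> n"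
    define k where "k = m div p"
    have p: "p > 0" using that by (simp add: p_def)
    have split: "real m = real k * real p + real (m mod p)"
      unfolding k_def by (metis div_mult_mod_eq of_nat_add of_nat_mult)
    have "real m / real p - real k = real (m mod p) / real p"
      using p split by (simp add: field_simps)
    moreover have "real (m mod p) / real p \<le> 1"
      using p by (simp add: less_imp_le)
    ultimately have "\<bar>real m / real p - real k\<bar> \<le> 1" by simp
    then have "\<bar>(real m / real p - real k) * w\<bar> \<le> \<bar>w\<bar>"
      by (simp add: abs_mult mult_left_le_one_le)
    then have "real m / real p * w - \<bar>w\<bar> \<le> real k * w" by (simp add: algebra_simps)
    also have "real k * w \<le> u (k * p)" using multiples[of k n] by (simp add: w_def p_def)
    also have "u (k * p) \<le> u m" using \<open>mono u\<close> by (rule monoD) (simp add: k_def)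
    finally have "(real m / real p * w - \<bar>w\<bar>) / real m \<le> u m / real m"
      by (rule divide_right_mono) simp
    moreover have "(real m / real p * w - \<bar>w\<bar>) / real m = v n - \<bar>w\<bar> / real m"
      using that by (simp add: v_def w_def p_def diff_divide_distrib)
    ultimately show ?thesis by (simp add: w_def)
  qed
  have upper: "u n / real n \<le> L * (1 + real c / real n) + \<delta> n / real n" if "n \<ge> 1" for n
  proof -
    have "v n \<le> L" unfolding L_def using that bdd by (intro cSUP_upper) auto
    then have "u n \<le> L * (real n + real c) + \<delta> n"
      using that by (simp add: v_def divide_le_eq)
    then have "u n / real n \<le> (L * (real n + real c) + \<delta> n) / real n"
      by (rule divide_right_mono) simp
    also have "\<dots> = L * (1 + real c / real n) + \<delta> n / real n"
      using that by (simp add: field_simps)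
    finally show ?thesis .
  qed
  have "(\<lambda>n. u n / real n) \<longlonglongrightarrow> L"
  proof (rule order_tendstoI)
    fix a assume "a < L"
    then obtain n where n: "n \<ge> 1" "a < v n"
      unfolding L_def using less_cSUP_iff[OF _ bdd] by auto
    have "(\<lambda>m. v n - \<bar>u n - \<delta> n\<bar> / real m) \<longlonglongrightarrow> v n" by real_asymp
    then have "\<forall>\<^sub>F m in sequentially. a < v n - \<bar>u n - \<delta> n\<bar> / real m"
      using n(2) by (rule order_tendstoD)
    then show "\<forall>\<^sub>F m in sequentially. a < u m / real m"
      using eventually_ge_at_top[of 1]
      by eventually_elim (use lower[OF n(1)] in force)
  next
    fix a assume "L < a"
    have "(\<lambda>n. L * (1 + real c / real n)) \<longlonglongrightarrow> L" by real_asymp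
    from tendsto_add[OF this sublinear]
    have "(\<lambda>n. L * (1 + real c / real n) + \<delta> n / real n) \<longlonglongrightarrow> L" by simp
    then have "\<forall>\<^sub>F n in sequentially. L * (1 + real c / real n) + \<delta> n / real n < a"
      using \<open>L < a\<close> by (rule order_tendstoD)
    then show "\<forall>\<^sub>F n in sequentially. u n / real n < a"
      using eventually_ge_at_top[of 1]
      by eventually_elim (use upper in force)
  qed
  then show ?thesis by (rule convergentI)
qed


section \<open>Word length\<close>

abbreviation letters :: "('a, 'b) monoid_scheme \<Rightarrow> 'a set \<Rightarrow> 'a set" where
  "letters G S \<equiv> S \<union> m_inv G ` S"

abbreviation word_value :: "('a, 'b) monoid_scheme \<Rightarrow> 'a list \<Rightarrow> 'a" where
  "word_value G w \<equiv> foldr (\<lambda>x y. x \<otimes>\<^bsub>G\<^esub> y) w \<one>\<^bsub>G\<^esub>"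

context group
begin

lemma letters_closed: "S \<subseteq> carrier G \<Longrightarrow> letters G S \<subseteq> carrier G"
  by auto

lemma word_value_closed: "set w \<subseteq> carrier G \<Longrightarrow> word_value G w \<in> carrier G"
  by (induction w) auto

lemma word_value_append:
  assumes "set v \<subseteq> carrier G" "set w \<subseteq> carrier G"
  shows "word_value G (v @ w) = word_value G v \<otimes> word_value G w"
  using assms(1)
proof (induction v)
  case Nil
  then show ?case using word_value_closed[OF assms(2)] by simp
next
  case (Cons x v)
  then have "x \<in> carrier G" "word_value G v \<in> carrier G" "word_value G w \<in> carrier G"
    and "word_value G (v @ w) = word_value G v \<otimes> word_value G w"
    using word_value_closed assms(2) by auto
  then show ?case by (simp add: m_assoc)
qed

lemma generate_word:
  assumes "S \<subseteq> carrier G" "g \<in> generate G S"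
  shows "\<exists>w. set w \<subseteq> letters G S \<and> word_value G w = g"
  using assms(2)
proof (induction rule: generate.induct)
  case one
  show ?case by (rule exI[of _ "[]"]) simp
next
  case (incl h)
  then show ?case using assms(1) by (intro exI[of _ "[h]"]) auto
next
  case (inv h)
  then show ?case using assms(1) by (intro exI[of _ "[inv h]"]) auto
next
  case (eng h1 h2)
  then obtain v w where "set v \<subseteq> letters G S" "word_value G v = h1"
    "set w \<subseteq> letters G S" "word_value G w = h2" by blast
  then show ?case
    using word_value_append[of v w] letters_closed[OF assms(1)]
    by (intro exI[of _ "v @ w"]) (metis le_supI order_trans set_append)
qed

lemma geodesic_word:
  assumes "S \<subseteq> carrier G" "g \<in> generate G S"
  obtains w where "length w = word_length G S g" "set w \<subseteq> letters G S" "word_value G w = g"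
proof -
  let ?spelled = "\<lambda>n. \<exists>w. length w = n \<and> set w \<subseteq> letters G S \<and> word_value G w = g"
  obtain v where "set v \<subseteq> letters G S" "word_value G v = g"
    using generate_word[OF assms] by auto
  then have "?spelled (length v)" by blast
  then have "?spelled (word_length G S g)" unfolding word_length_def by (rule LeastI)
  then show ?thesis using that by auto
qed

lemma word_length_le:
  "set w \<subseteq> letters G S \<Longrightarrow> word_length G S (word_value G w) \<le> length w"
  unfolding word_length_def by (rule Least_le) blast

lemma word_length_mult_le:
  assumes "S \<subseteq> carrier G" "g \<in> generate G S" "h \<in> generate G S"
  shows "word_length G S (g \<otimes> h) \<le> word_length G S g + word_length G S h"
proof -
  obtain v where v: "length v = word_length G S g" "set v \<subseteq> letters G S" "word_value G v = g"
    using geodesic_word[OF assms(1,2)] .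
  obtain w where w: "length w = word_length G S h" "set w \<subseteq> letters G S" "word_value G w = h"
    using geodesic_word[OF assms(1,3)] .
  have "word_value G (v @ w) = g \<otimes> h"
    using word_value_append[of v w] v w letters_closed[OF assms(1)] by (metis order_trans)
  with word_length_le[of "v @ w" S] v w show ?thesis by simp
qed

lemma word_ball_growth:
  assumes "finite S" "S \<subseteq> carrier G" "generate G S = carrier G"
  shows "finite (word_ball G S n)"
    and "card (word_ball G S n) \<le> (1 + card (letters G S)) ^ n"
proof -
  let ?W = "{w. set w \<subseteq> letters G S \<and> length w \<le> n}"
  have fin: "finite (letters G S)" using assms(1) by simp
  have sub: "word_ball G S n \<subseteq> word_value G ` ?W"
  proof
    fix g assume "g \<in> word_ball G S n"
    then have g: "g \<in> generate G S" "word_length G S g \<le> n"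
      using assms(3) by (auto simp: word_ball_def)
    obtain w where "length w = word_length G S g" "set w \<subseteq> letters G S" "word_value G w = g"
      using geodesic_word[OF assms(2) g(1)] .
    with g(2) show "g \<in> word_value G ` ?W" by auto
  qed
  have finW: "finite ?W" using fin by (rule finite_lists_length_le)
  show "finite (word_ball G S n)" using sub finW by (meson finite_imageI finite_subset)
  have "card (word_ball G S n) \<le> card ?W"
    using sub finW by (meson card_image_le card_mono finite_imageI order_trans)
  also have "\<dots> = (\<Sum>i\<le>n. card (letters G S) ^ i)" using fin by (rule card_lists_length_le)
  also have "\<dots> \<le> (1 + card (letters G S)) ^ n"
  proof (induction n)
    case (Suc n)
    have "card (letters G S) ^ Suc n \<le> card (letters G S) * (1 + card (letters G S)) ^ n"
      unfolding power_Suc by (intro mult_left_mono power_mono) auto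
    from add_mono[OF Suc this] show ?case by simp
  qed simp
  finally show "card (word_ball G S n) \<le> (1 + card (letters G S)) ^ n" .
qed


section \<open>Rapid decay makes product sets large\<close>

text \<open>
  A supremum of reals says something about its members only when they are bounded.  Here they
  are: the pointwise Cauchy--Schwarz inequality bounds the square of the image by a multiple
  of the sum of finitely many translates of \<open>|\<xi>|\<^sup>2\<close>, and translation preserves square sums.
\<close>

lemma left_regular_fun_bounded:
  assumes "finitely_supported G f"
  shows "bdd_above {ell2_norm G (left_regular_fun G f \<xi>) | \<xi>. \<xi> \<in> ell2 G \<and> ell2_norm G \<xi> \<le> 1}"
proof -
  define F where "F = {t \<in> carrier G. f t \<noteq> 0}"
  have finF: "finite F" using assms by (simp add: finitely_supported_def F_def)
  define M where "M = (\<Sum>t\<in>F. (cmod (f t))\<^sup>2)"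
  have "M \<ge> 0" by (simp add: M_def sum_nonneg)
  have "ell2_norm G (left_regular_fun G f \<xi>) \<le> sqrt (M * real (card F))"
    if "\<xi> \<in> ell2 G" and "ell2_norm G \<xi> \<le> 1" for \<xi>
  proof -
    let ?s = "\<lambda>g. (cmod (\<xi> g))\<^sup>2"
    have summ: "?s summable_on carrier G" using that(1) by (simp add: ell2_def)
    have unit: "infsum ?s (carrier G) \<le> 1" using that(2) by (simp add: ell2_norm_def)
    have pointwise:
      "(cmod (left_regular_fun G f \<xi> h))\<^sup>2 \<le> M * (\<Sum>t\<in>F. ?s (inv t \<otimes> h))" for h
    proof -
      have "cmod (left_regular_fun G f \<xi> h) \<le> (\<Sum>t\<in>F. cmod (f t) * cmod (\<xi> (inv t \<otimes> h)))"
        unfolding left_regular_fun_def left_regular_def F_def[symmetric]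
        by (rule sum_norm_le) (simp add: norm_mult)
      then have "(cmod (left_regular_fun G f \<xi> h))\<^sup>2
          \<le> (\<Sum>t\<in>F. cmod (f t) * cmod (\<xi> (inv t \<otimes> h)))\<^sup>2"
        by (simp add: power_mono)
      also have "\<dots> \<le> M * (\<Sum>t\<in>F. ?s (inv t \<otimes> h))"
        unfolding M_def by (rule Cauchy_Schwarz_ineq_sum)
      finally show ?thesis .
    qed
    have finite_sums: "(\<Sum>h\<in>H. (cmod (left_regular_fun G f \<xi> h))\<^sup>2) \<le> M * real (card F)"
      if H: "finite H" "H \<subseteq> carrier G" for H
    proof -
      have translate: "(\<Sum>h\<in>H. ?s (inv t \<otimes> h)) \<le> 1" if "t \<in> F" for t
      proof -
        have t: "t \<in> carrier G" using that by (simp add: F_def)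
        have inj: "inj_on (\<lambda>h. inv t \<otimes> h) H"
          using t H(2) inj_on_cmult[of "inv t"] by (auto intro: inj_on_subset)
        have "(\<Sum>h\<in>H. ?s (inv t \<otimes> h)) = (\<Sum>g\<in>(\<lambda>h. inv t \<otimes> h) ` H. ?s g)"
          using inj by (simp add: sum.reindex)
        also have "\<dots> \<le> infsum ?s (carrier G)"
          by (rule finite_sum_le_infsum[OF summ]) (use H t in auto)
        finally show ?thesis using unit by simp
      qed
      have "(\<Sum>h\<in>H. (cmod (left_regular_fun G f \<xi> h))\<^sup>2)
          \<le> (\<Sum>h\<in>H. M * (\<Sum>t\<in>F. ?s (inv t \<otimes> h)))"
        by (rule sum_mono) (rule pointwise)
      also have "\<dots> = M * (\<Sum>t\<in>F. \<Sum>h\<in>H. ?s (inv t \<otimes> h))"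
        by (simp add: sum_distrib_left[symmetric] sum.swap[of _ F H])
      also have "\<dots> \<le> M * (\<Sum>t\<in>F. 1)"
        using translate \<open>M \<ge> 0\<close> by (intro mult_left_mono sum_mono) auto
      finally show ?thesis by simp
    qed
    \<comment> \<open>A sum that does not converge has the value \<open>0\<close>, which respects the bound as well.\<close>
    have "(\<Sum>\<^sub>\<infinity>h\<in>carrier G. (cmod (left_regular_fun G f \<xi> h))\<^sup>2) \<le> M * real (card F)"
    proof (cases "(\<lambda>h. (cmod (left_regular_fun G f \<xi> h))\<^sup>2) summable_on carrier G")
      case True
      then show ?thesis using finite_sums by (rule infsum_le_finite_sums)
    next
      case False
      then show ?thesis using \<open>M \<ge> 0\<close> by (simp add: infsum_not_exists)
    qed
    then show ?thesis by (simp add: ell2_norm_def)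
  qed
  then show ?thesis by (intro bdd_aboveI[of _ "sqrt (M * real (card F))"]) auto
qed

lemma infsum_finite_support:
  fixes \<phi> :: "'a \<Rightarrow> real"
  assumes "finite F" "F \<subseteq> B" "\<And>x. x \<in> B - F \<Longrightarrow> \<phi> x = 0"
  shows "\<phi> summable_on B" and "infsum \<phi> B = sum \<phi> F"
proof -
  have "\<phi> summable_on F" using assms(1) by simp
  then show "\<phi> summable_on B"
    using summable_on_cong_neutral[of B F \<phi> \<phi>] assms by auto
  have "infsum \<phi> B = infsum \<phi> F"
    using assms by (intro infsum_cong_neutral) auto
  then show "infsum \<phi> B = sum \<phi> F" using assms(1) by simp
qed

text \<open>
  Testing the operator on the normalised indicator of \<open>Q\<close> gives a function on \<open>PQ\<close>
  whose values sum to \<open>|P| \<surd>|Q|\<close> and whose square sum is at most the squared norm;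
  Cauchy--Schwarz on \<open>PQ\<close> compares the two.
\<close>

lemma card_mult_le_op_norm:
  assumes P: "finite P" "P \<subseteq> carrier G" and Q: "finite Q" "Q \<subseteq> carrier G"
  defines "N \<equiv> ell2_op_norm G (left_regular_fun G (indicator P))"
  shows "(real (card P))\<^sup>2 * real (card Q) \<le> real (card (P <#> Q)) * N\<^sup>2"
proof (cases "Q = {}")
  case True
  then show ?thesis by simp
next
  case False
  define q where "q = sqrt (real (card Q))"
  have q: "q > 0" "q\<^sup>2 = real (card Q)"
    using False Q(1) by (simp_all add: q_def card_gt_0_iff)
  define \<xi> :: "'a \<Rightarrow> complex" where "\<xi> = (\<lambda>g. complex_of_real (indicator Q g / q))"
  define T where "T = left_regular_fun G (indicator P)"
  define R where "R = P <#> Q"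
  have supp: "{t \<in> carrier G. (indicator P t :: complex) \<noteq> 0} = P"
    using P(2) by (auto simp: indicator_def)
  have R: "finite R" "R \<subseteq> carrier G"
    using P Q set_mult_closed[of P Q] by (auto simp: R_def set_mult_def)
  have T: "T \<xi> h = complex_of_real (\<Sum>t\<in>P. indicator Q (inv t \<otimes> h) / q)" for h
    unfolding T_def left_regular_fun_def supp left_regular_def \<xi>_def
    by (simp add: indicator_def)
  have zero: "T \<xi> h = 0" if "h \<in> carrier G - R" for h
  proof -
    have "inv t \<otimes> h \<notin> Q" if "t \<in> P" for t
    proof
      assume *: "inv t \<otimes> h \<in> Q"
      have "t \<in> carrier G" using P(2) that by auto
      then have "h = t \<otimes> (inv t \<otimes> h)"
        using \<open>h \<in> carrier G - R\<close> by (simp add: m_assoc[symmetric])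
      with * that have "h \<in> R" unfolding R_def set_mult_def by blast
      with \<open>h \<in> carrier G - R\<close> show False by simp
    qed
    then show ?thesis unfolding T by simp
  qed
  have fibre: "(\<Sum>h\<in>R. indicator Q (inv t \<otimes> h)) = real (card Q)" if "t \<in> P" for t
  proof -
    have t: "t \<in> carrier G" using P(2) that by auto
    have "bij_betw (\<lambda>g. t \<otimes> g) Q {h \<in> R. inv t \<otimes> h \<in> Q}"
    proof (rule bij_betw_byWitness[where f' = "\<lambda>h. inv t \<otimes> h"])
      show "\<forall>g\<in>Q. inv t \<otimes> (t \<otimes> g) = g"
        using t Q(2) by (auto simp: m_assoc[symmetric] subset_iff)
      show "\<forall>h\<in>{h \<in> R. inv t \<otimes> h \<in> Q}. t \<otimes> (inv t \<otimes> h) = h"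
        using t R(2) by (auto simp: m_assoc[symmetric] subset_iff)
      show "(\<lambda>g. t \<otimes> g) ` Q \<subseteq> {h \<in> R. inv t \<otimes> h \<in> Q}"
        using t Q(2) that by (auto simp: R_def set_mult_def m_assoc[symmetric] subset_iff)
    qed auto
    then have "card {h \<in> R. inv t \<otimes> h \<in> Q} = card Q"
      by (metis bij_betw_same_card)
    moreover have "(\<Sum>h\<in>R. indicator Q (inv t \<otimes> h)) = real (card {h \<in> R. inv t \<otimes> h \<in> Q})"
      using R(1) by (simp add: indicator_def sum.If_cases Int_def)
    ultimately show ?thesis by simp
  qed
  have total: "(\<Sum>h\<in>R. cmod (T \<xi> h)) = real (card P) * q"
  proof -
    have "cmod (T \<xi> h) = (\<Sum>t\<in>P. indicator Q (inv t \<otimes> h) / q)" for h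
      unfolding T norm_of_real using q(1) by (intro abs_of_nonneg sum_nonneg) simp
    then have "(\<Sum>h\<in>R. cmod (T \<xi> h)) = (\<Sum>t\<in>P. (\<Sum>h\<in>R. indicator Q (inv t \<otimes> h)) / q)"
      by (simp add: sum.swap[of _ P R] sum_divide_distrib)
    also have "\<dots> = real (card P) * (q\<^sup>2 / q)" by (simp add: fibre q(2))
    finally show ?thesis using q(1) by (simp add: power2_eq_square)
  qed
  have square: "(\<Sum>h\<in>R. (cmod (T \<xi> h))\<^sup>2) \<le> N\<^sup>2"
  proof -
    note fs = infsum_finite_support[OF Q, of "\<lambda>g. (cmod (\<xi> g))\<^sup>2"]
    have "\<xi> \<in> ell2 G" using fs(1) by (simp add: ell2_def \<xi>_def)
    moreover have "ell2_norm G \<xi> = sqrt (\<Sum>g\<in>Q. (cmod (\<xi> g))\<^sup>2)"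
      unfolding ell2_norm_def by (subst fs(2)) (simp_all add: \<xi>_def)
    then have "ell2_norm G \<xi> = 1"
      using q False Q(1) by (simp add: \<xi>_def norm_divide power_divide card_gt_0_iff)
    moreover have "finitely_supported G (indicator P)"
      unfolding finitely_supported_def supp using P(1) .
    ultimately have "ell2_norm G (T \<xi>) \<le> N"
      unfolding N_def ell2_op_norm_def T_def
      by (intro cSup_upper left_regular_fun_bounded) auto
    moreover have "ell2_norm G (T \<xi>) = sqrt (\<Sum>h\<in>R. (cmod (T \<xi> h))\<^sup>2)"
      unfolding ell2_norm_def
      using infsum_finite_support(2)[OF R, of "\<lambda>h. (cmod (T \<xi> h))\<^sup>2"] zero by simp
    ultimately show ?thesis by (simp add: sqrt_le_D)
  qed
  have "(real (card P) * q)\<^sup>2 \<le> (\<Sum>h\<in>R. (cmod (T \<xi> h))\<^sup>2) * real (card R)"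
    using sum_squared_le_sum_of_squares[of "\<lambda>h. cmod (T \<xi> h)" R] by (simp add: total)
  also have "\<dots> \<le> N\<^sup>2 * real (card R)"
    using square by (intro mult_right_mono) auto
  finally show ?thesis by (simp add: power_mult_distrib q(2) R_def mult.commute)
qed

lemma weighted_norm_indicator_le:
  assumes "finite P" "P \<subseteq> word_ball G S n" "s \<ge> 0"
  shows "(ell2_weighted_norm G S s (indicator P))\<^sup>2
      \<le> real (card P) * (1 + real n) powr (2 * s)"
proof -
  let ?\<phi> = "\<lambda>g. (cmod (indicator P g))\<^sup>2 * (1 + real (word_length G S g)) powr (2 * s)"
  have sub: "P \<subseteq> carrier G" using assms(2) by (auto simp: word_ball_def)
  have "infsum ?\<phi> (carrier G) = sum ?\<phi> P"
    using assms(1) sub by (intro infsum_finite_support(2)) auto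
  also have "\<dots> \<le> (\<Sum>g\<in>P. (1 + real n) powr (2 * s))"
    using assms by (intro sum_mono) (auto simp: word_ball_def intro!: powr_mono2)
  finally have "infsum ?\<phi> (carrier G) \<le> real (card P) * (1 + real n) powr (2 * s)" by simp
  moreover have "infsum ?\<phi> (carrier G) \<ge> 0" by (rule infsum_nonneg) simp
  ultimately show ?thesis by (simp add: ell2_weighted_norm_def)
qed

text \<open>
  The weight in rapid decay is applied to the indicator of \<open>P\<close> alone, which is why
  \<open>Q\<close> may be any finite set, however far from the identity.
\<close>

lemma rapid_decay_card_product:
  assumes "rapid_decay G S"
  obtains s K where "s \<ge> 0" "K > 0"
    "\<And>P Q n. \<lbrakk>finite P; P \<subseteq> word_ball G S n; finite Q; Q \<subseteq> carrier G\<rbrakk>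
      \<Longrightarrow> real (card P) * real (card Q) \<le> K * (1 + real n) powr (2 * s) * real (card (P <#> Q))"
proof -
  obtain s C where sC: "s \<ge> 0" "C > 0"
    and decay: "\<And>f. finitely_supported G f
      \<Longrightarrow> ell2_op_norm G (left_regular_fun G f) \<le> C * ell2_weighted_norm G S s f"
    using assms unfolding rapid_decay_def by blast
  show ?thesis
  proof (rule that[OF sC(1)])
    show "C\<^sup>2 > 0" using sC(2) by simp
    fix P Q :: "'a set" and n :: nat
    assume P: "finite P" "P \<subseteq> word_ball G S n" and Q: "finite Q" "Q \<subseteq> carrier G"
    let ?p = "real (card P)" and ?q = "real (card Q)" and ?r = "real (card (P <#> Q))"
    let ?N = "ell2_op_norm G (left_regular_fun G (indicator P))"
    let ?W = "(1 + real n) powr (2 * s)"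
    have subP: "P \<subseteq> carrier G" using P(2) by (auto simp: word_ball_def)
    show "?p * ?q \<le> C\<^sup>2 * ?W * ?r"
    proof (cases "P = {} \<or> Q = {}")
      case False
      then have pq: "?p > 0" "?q > 0" using P Q by (simp_all add: card_gt_0_iff)
      have main: "?p\<^sup>2 * ?q \<le> ?r * ?N\<^sup>2"
        using card_mult_le_op_norm[OF P(1) subP Q] .
      have "finitely_supported G (indicator P)"
        using P(1) by (auto simp: finitely_supported_def indicator_def)
      then have le: "?N \<le> C * ell2_weighted_norm G S s (indicator P)" by (rule decay)
      have "?N \<ge> 0"
      proof -
        have "bdd_above {ell2_norm G (left_regular_fun G (indicator P) \<xi>) | \<xi>.
            \<xi> \<in> ell2 G \<and> ell2_norm G \<xi> \<le> 1}"
          using \<open>finitely_supported G (indicator P)\<close> by (rule left_regular_fun_bounded)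
        moreover have "(\<lambda>g. 0) \<in> ell2 G" "ell2_norm G (\<lambda>g. 0) \<le> 1"
          by (simp_all add: ell2_def ell2_norm_def)
        ultimately have "ell2_norm G (left_regular_fun G (indicator P) (\<lambda>g. 0)) \<le> ?N"
          unfolding ell2_op_norm_def by (intro cSup_upper) auto
        moreover have "ell2_norm G (left_regular_fun G (indicator P) (\<lambda>g. 0)) = 0"
          by (simp add: ell2_norm_def left_regular_fun_def left_regular_def)
        ultimately show ?thesis by simp
      qed
      with le have "?N\<^sup>2 \<le> (C * ell2_weighted_norm G S s (indicator P))\<^sup>2"
        by (rule power_mono)
      also have "\<dots> \<le> C\<^sup>2 * (?p * ?W)"
        unfolding power_mult_distrib
        using weighted_norm_indicator_le[OF P sC(1)] by (intro mult_left_mono) auto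
      finally have "?r * ?N\<^sup>2 \<le> ?r * (C\<^sup>2 * (?p * ?W))" by (intro mult_left_mono) auto
      with main have "?p * (?p * ?q) \<le> ?p * (C\<^sup>2 * ?W * ?r)"
        by (simp add: power2_eq_square mult_ac)
      with pq(1) show ?thesis by simp
    qed auto
  qed
qed


section \<open>Growth of approximate semigroups\<close>

text \<open>
  Controlling the product by \<open>A\<close> itself, and not by \<open>A\<^sup>2\<close>, is what lets the estimate
  be iterated; the price is the bounded shift \<open>c\<close> and the factor \<open>k\<close>, both independent
  of the radii.
\<close>

lemma approximate_semigroup_product:
  assumes S: "finite S" "S \<subseteq> carrier G" "generate G S = carrier G"
    and A: "approximate_semigroup G A"
  obtains c k :: nat where
    "\<And>m n. card ((A \<inter> word_ball G S n) <#> (A \<inter> word_ball G S m))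
      \<le> card (A \<inter> word_ball G S (m + n + c)) * k"
proof -
  obtain X where subA: "A \<subseteq> carrier G" and X: "finite X" "X \<subseteq> carrier G"
    and prod: "A <#> A \<subseteq> A <#> X"
    using A unfolding approximate_semigroup_def by blast
  \<comment> \<open>If \<open>ab = a'x\<close> then \<open>a' = ab x\<^sup>-\<^sup>1\<close>, so it is the inverses of \<open>X\<close> that must be bounded.\<close>
  define c where "c = (\<Sum>x\<in>X. word_length G S (inv x))"
  show ?thesis
  proof (rule that[of c "card X"])
    fix m n
    let ?R = "A \<inter> word_ball G S (m + n + c)"
    have "(A \<inter> word_ball G S n) <#> (A \<inter> word_ball G S m) \<subseteq> (\<lambda>(a, x). a \<otimes> x) ` (?R \<times> X)"
    proof
      fix g assume "g \<in> (A \<inter> word_ball G S n) <#> (A \<inter> word_ball G S m)"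
      then obtain a b where ab: "a \<in> A" "b \<in> A" "g = a \<otimes> b"
        "word_length G S a \<le> n" "word_length G S b \<le> m"
        by (auto simp: set_mult_def word_ball_def)
      then have "g \<in> A <#> A" unfolding set_mult_def by blast
      with prod have "g \<in> A <#> X" ..
      then obtain a' x where ax: "a' \<in> A" "x \<in> X" "g = a' \<otimes> x"
        by (auto simp: set_mult_def)
      have cl: "a \<in> carrier G" "b \<in> carrier G" "a' \<in> carrier G" "x \<in> carrier G"
        using ab ax subA X(2) by auto
      have "a' = (a \<otimes> b) \<otimes> inv x"
        using ab(3) ax(3) cl by (simp add: inv_solve_right)
      then have "word_length G S a' \<le> word_length G S (a \<otimes> b) + word_length G S (inv x)"
        using word_length_mult_le[OF S(2), of "a \<otimes> b" "inv x"] S(3) cl by simp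
      also have "word_length G S (a \<otimes> b) \<le> n + m"
        using word_length_mult_le[OF S(2), of a b] S(3) cl ab by simp
      also have "word_length G S (inv x) \<le> c"
        unfolding c_def using X(1) ax(2) by (intro member_le_sum) auto
      finally have "a' \<in> ?R" using ax(1) cl(3) by (simp add: word_ball_def add.commute)
      with ax show "g \<in> (\<lambda>(a, x). a \<otimes> x) ` (?R \<times> X)" by force
    qed
    moreover have fin: "finite (?R \<times> X)"
      using X(1) word_ball_growth(1)[OF S] by simp
    ultimately have "card ((A \<inter> word_ball G S n) <#> (A \<inter> word_ball G S m)) \<le> card (?R \<times> X)"
      by (meson card_image_le card_mono finite_imageI order_trans)
    then show "card ((A \<inter> word_ball G S n) <#> (A \<inter> word_ball G S m)) \<le> card ?R * card X"
      by (simp add: card_cartesian_product)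
  qed
qed

end

text \<open>
  Small balls may miss \<open>A\<close>, but the estimates hold at those radii too: there \<open>ln 0 = 0\<close>
  keeps \<open>u\<close> nonnegative and monotone, and the almost superadditivity of \<open>u\<close> reduces to
  monotonicity since \<open>\<delta> \<ge> 0\<close>.
\<close>

theorem corollary7p5:
  fixes G :: "('a, 'b) monoid_scheme" and S A :: "'a set"
  assumes "group G"
    and "finite S" and "S \<subseteq> carrier G" and "generate G S = carrier G"
    and "rapid_decay G S"
    and "approximate_semigroup G A" and "A \<noteq> {}"
  shows "convergent (\<lambda>n::nat. 1 / real n * ln (real (card (A \<inter> word_ball G S n))))"
proof -
  interpret group G by fact
  note S = assms(2-4)
  define a where "a n = card (A \<inter> word_ball G S n)" for n
  define u where "u n = ln (real (a n))" for n
  obtain s K where sK: "s \<ge> 0" "K > 0"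
    and large: "\<And>P Q n. \<lbrakk>finite P; P \<subseteq> word_ball G S n; finite Q; Q \<subseteq> carrier G\<rbrakk>
      \<Longrightarrow> real (card P) * real (card Q) \<le> K * (1 + real n) powr (2 * s) * real (card (P <#>\<^bsub>G\<^esub> Q))"
    by (rule rapid_decay_card_product[OF assms(5)]) blast
  obtain c k where small:
    "\<And>m n. card ((A \<inter> word_ball G S n) <#>\<^bsub>G\<^esub> (A \<inter> word_ball G S m)) \<le> a (m + n + c) * k"
    using approximate_semigroup_product[OF S assms(6)] unfolding a_def by blast
  define E where "E = max 1 (K * real k)"
  define \<delta> where "\<delta> n = ln E + 2 * s * ln (1 + real n)" for n :: nat
  have E: "E \<ge> 1" "K * real k \<le> E" by (simp_all add: E_def)
  have \<delta>_nonneg: "\<delta> n \<ge> 0" for n using E sK by (simp add: \<delta>_def)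
  have u_nonneg: "u n \<ge> 0" for n by (cases "a n") (simp_all add: u_def)
  have a_mono: "a m \<le> a n" if "m \<le> n" for m n
    unfolding a_def using that word_ball_growth(1)[OF S]
    by (intro card_mono) (auto simp: word_ball_def)
  have "mono u"
  proof (rule monoI)
    fix m n :: nat assume "m \<le> n"
    show "u m \<le> u n"
    proof (cases "a m = 0")
      case True
      then show ?thesis using u_nonneg[of n] by (simp add: u_def)
    next
      case False
      with a_mono[OF \<open>m \<le> n\<close>] show ?thesis by (simp add: u_def)
    qed
  qed
  moreover have "u n \<le> ln (1 + real (card (letters G S))) * real n" for n
  proof (cases "a n = 0")
    case False
    have "a n \<le> card (word_ball G S n)"
      unfolding a_def using word_ball_growth(1)[OF S] by (intro card_mono) auto
    also have "\<dots> \<le> (1 + card (letters G S)) ^ n" by (rule word_ball_growth(2)[OF S])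
    finally have "real (a n) \<le> (1 + real (card (letters G S))) ^ n"
      by (metis of_nat_1 of_nat_add of_nat_le_iff of_nat_power)
    then have "u n \<le> ln ((1 + real (card (letters G S))) ^ n)"
      unfolding u_def using False by (intro ln_mono) auto
    then show ?thesis by (simp add: ln_realpow mult.commute)
  qed (simp add: u_def)
  moreover have "u m + u n \<le> u (m + n + c) + \<delta> n" for m n
  proof (cases "a m = 0 \<or> a n = 0")
    case True
    moreover have "u m \<le> u (m + n + c)" "u n \<le> u (m + n + c)"
      using \<open>mono u\<close> by (auto intro: monoD)
    ultimately show ?thesis using \<delta>_nonneg[of n] by (auto simp: u_def)
  next
    case False
    let ?W = "(1 + real n) powr (2 * s)"
    have "A \<subseteq> carrier G" using assms(6) by (simp add: approximate_semigroup_def)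
    then have "real (a n) * real (a m)
        \<le> K * ?W * real (card ((A \<inter> word_ball G S n) <#>\<^bsub>G\<^esub> (A \<inter> word_ball G S m)))"
      unfolding a_def using word_ball_growth(1)[OF S] by (intro large) auto
    also have "\<dots> \<le> K * ?W * (real (a (m + n + c)) * real k)"
      using small[of n m] sK(2)
      by (intro mult_left_mono) (auto simp flip: of_nat_mult)
    also have "\<dots> = K * real k * (?W * real (a (m + n + c)))" by simp
    also have "\<dots> \<le> E * (?W * real (a (m + n + c)))"
      using E(2) by (intro mult_right_mono) auto
    finally have le: "real (a n) * real (a m) \<le> E * (?W * real (a (m + n + c)))" .
    have pos: "a m > 0" "a n > 0" "a (m + n + c) > 0"
      using False a_mono[of m "m + n + c"] by auto
    have "u m + u n = ln (real (a n) * real (a m))" using pos by (simp add: u_def ln_mult)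
    also have "\<dots> \<le> ln (E * (?W * real (a (m + n + c))))"
      using le pos by (intro ln_mono) auto
    also have "\<dots> = u (m + n + c) + \<delta> n"
      using pos E(1) by (simp add: ln_mult u_def \<delta>_def ln_powr)
    finally show ?thesis .
  qed
  moreover have "(\<lambda>n. \<delta> n / real n) \<longlonglongrightarrow> 0" unfolding \<delta>_def by real_asymp
  ultimately have "convergent (\<lambda>n. u n / real n)"
    using u_nonneg[of 0] by (intro almost_superadditive_convergent)
  then show ?thesis by (simp add: u_def a_def)
qed

end
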